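(* The Cartan canonical $\Gamma$-linear connection produced by the jet conformal Minkowski metric $F$ has the following adapted local components: $$C\Gamma=\left(\varkappa_{11}^1,\ G_{j1}^k=0,\ L_{jk}^i,\ C_{j(k)}^{i(1)}=0\right),$$ where $$L_{jk}^i=\delta_j^i\sigma_k+\delta_k^i\sigma_j+(1-\delta_{jk})\sigma_i-\frac{1-\delta_{jk}}{3}\operatorname{div}D_\sigma.$$
   Context: $h_{11}(t)>0$ is a smooth Riemannian metric on $\mathbb{R}$, $h^{11}=1/h_{11}$, and $\varkappa_{11}^1=\frac{h^{11}}{2}\frac{dh_{11}}{dt}$ is its Christoffel symbol. $M^4$ is a smooth 4-manifold with local coordinates $x=(x^1,\dots,x^4)$, and $\sigma$ is a smooth non-constant function on $M^4$, with $\sigma_i=\partial\sigma/\partial x^i$. The 1-jet space $J^1(\mathbb{R},M^4)$ has local coordinates $(t,x,y)$, $y=(y_1^1,\dots,y_1^4)$. The jet conformal Minkowski metric is $F(t,x,y)=e^{\sigma(x)}\sqrt{h^{11}(t)}\sqrt{G_{11}(y)}$ with $G_{11}(y)=y_1^1y_1^2+y_1^1y_1^3+y_1^1y_1^4+y_1^2y_1^3+y_1^2y_1^4+y_1^3y_1^4$, on the domain $G_{11}(y)>0$. Latin indices run from 1 to 4, the Einstein summation convention is used for an index repeated in upper and lower position, and $\delta^i_j,\delta_{ij}$ are Kronecker symbols. Notation: $S_{[1]1}=y_1^1+y_1^2+y_1^3+y_1^4$ and $\operatorname{div}D_\sigma=\sigma_1+\sigma_2+\sigma_3+\sigma_4$.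 The fundamental metrical d-tensor is $g_{ij}=\frac{h_{11}}{2}\frac{\partial^2F^2}{\partial y_1^i\partial y_1^j}=\frac{e^{2\sigma(x)}}{2}(1-\delta_{ij})$, with inverse matrix $(g^{ij})$. The canonical nonlinear connection $\Gamma$ of $F$ has components $M_{(1)1}^{(i)}=-\varkappa_{11}^1y_1^i$ and $N_{(1)j}^{(i)}=\sigma_jy_1^i+\sigma_my_1^m\delta_j^i+[\sigma_i-\frac13\operatorname{div}D_\sigma](S_{[1]1}-y_1^j)$, and the adapted vector fields are $$\frac{\delta}{\delta t}=\frac{\partial}{\partial t}+\varkappa_{11}^1y_1^p\frac{\partial}{\partial y_1^p},\qquad\frac{\delta}{\delta x^i}=\frac{\partial}{\partial x^i}-N_{(1)i}^{(p)}\frac{\partial}{\partial y_1^p},\qquad\frac{\partial}{\partial y_1^i}.$$ The Cartan canonical $\Gamma$-linear connection of $F$ is, by definition, the connection with adapted components $(\varkappa_{11}^1,G_{j1}^k,L_{jk}^i,C_{j(k)}^{i(1)})$, where $$G_{j1}^k=\frac{g^{km}}{2}\frac{\delta g_{mj}}{\delta t},\quad L_{jk}^i=\frac{g^{im}}{2}\left(\frac{\delta g_{jm}}{\delta x^k}+\frac{\delta g_{km}}{\delta x^j}-\frac{\delta g_{jk}}{\delta x^m}\right),\quad C_{j(k)}^{i(1)}=\frac{g^{im}}{2}\left(\frac{\partial g_{jm}}{\partial y_1^k}+\frac{\partial g_{km}}{\partial y_1^j}-\frac{\partial g_{jk}}{\partial y_1^m}\right).$$ *)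

theory Defs
  imports "HOL-Analysis.Analysis"
begin

section \<open>Smooth 4-manifolds\<close>

text \<open>Intended for open \<open>S\<close>.\<close>

primrec Ck_on :: "nat \<Rightarrow> ('a::real_normed_vector \<Rightarrow> 'b::real_normed_vector) \<Rightarrow> 'a set \<Rightarrow> bool" where
  "Ck_on 0 f S \<longleftrightarrow> continuous_on S f"
| "Ck_on (Suc k) f S \<longleftrightarrow>
     (\<forall>x\<in>S. f differentiable (at x)) \<and>
     (\<forall>v. Ck_on k (\<lambda>x. frechet_derivative f (at x) v) S)"

definition smooth_on :: "('a::real_normed_vector \<Rightarrow> 'b::real_normed_vector) \<Rightarrow> 'a set \<Rightarrow> bool" where
  "smooth_on f S \<longleftrightarrow> (\<forall>k. Ck_on k f S)"

type_synonym 'm chart = "'m set \<times> ('m \<Rightarrow> real ^ 4)"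

text \<open>A 4-manifold is a Hausdorff second-countable type \<open>'m\<close> with a smooth atlas.
  The atlas need not be maximal.\<close>

definition smooth_atlas :: "'m::{t2_space, second_countable_topology} chart set \<Rightarrow> bool" where
  "smooth_atlas A \<longleftrightarrow>
     (\<Union>(U, \<phi>)\<in>A. U) = UNIV \<and>
     (\<forall>(U, \<phi>)\<in>A. open U \<and> open (\<phi> ` U) \<and>
        homeomorphism U (\<phi> ` U) \<phi> (the_inv_into U \<phi>)) \<and>
     (\<forall>(U, \<phi>)\<in>A. \<forall>(V, \<psi>)\<in>A. smooth_on (\<psi> \<circ> the_inv_into U \<phi>) (\<phi> ` (U \<inter> V)))"

definition in_chart :: "'m chart \<Rightarrow> ('m \<Rightarrow> real) \<Rightarrow> real ^ 4 \<Rightarrow> real" where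
  "in_chart c f = f \<circ> the_inv_into (fst c) (snd c)"

definition smooth_function ::
  "'m::{t2_space, second_countable_topology} chart set \<Rightarrow> ('m \<Rightarrow> real) \<Rightarrow> bool" where
  "smooth_function A f \<longleftrightarrow> (\<forall>c\<in>A. smooth_on (in_chart c f) (snd c ` fst c))"


section \<open>Local geometry of the 1-jet space\<close>

text \<open>A point of the 1-jet space has local coordinates \<open>(t, x, y)\<close>.
  The index type is \<open>4\<close>, whose elements are \<open>1, 2, 3, 4\<close> (with \<open>4 = 0\<close>).\<close>

type_synonym jet_fun = "real \<Rightarrow> real ^ 4 \<Rightarrow> real ^ 4 \<Rightarrow> real"

definition kdelta :: "4 \<Rightarrow> 4 \<Rightarrow> real" where
  "kdelta i j = (if i = j then 1 else 0)"

definition partial :: "4 \<Rightarrow> (real ^ 4 \<Rightarrow> real) \<Rightarrow> real ^ 4 \<Rightarrow> real" where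
  "partial i f x = deriv (\<lambda>s. f (x + s *\<^sub>R axis i 1)) 0"

definition d_t :: "jet_fun \<Rightarrow> jet_fun" where
  "d_t f t x y = deriv (\<lambda>s. f s x y) t"

definition d_x :: "4 \<Rightarrow> jet_fun \<Rightarrow> jet_fun" where
  "d_x i f t x y = partial i (\<lambda>z. f t z y) x"

definition d_y :: "4 \<Rightarrow> jet_fun \<Rightarrow> jet_fun" where
  "d_y i f t x y = partial i (\<lambda>z. f t x z) y"

definition christoffel :: "(real \<Rightarrow> real) \<Rightarrow> real \<Rightarrow> real" where
  "christoffel h t = (1 / h t) / 2 * deriv h t"

text \<open>A nonlinear connection is given by its components: \<open>M i\<close> is $M^{(i)}_{(1)1}$ and
  \<open>N i j\<close> is $N^{(i)}_{(1)j}$.\<close>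

definition delta_t :: "(4 \<Rightarrow> jet_fun) \<Rightarrow> jet_fun \<Rightarrow> jet_fun" where
  "delta_t M f t x y = d_t f t x y - (\<Sum>p\<in>UNIV. M p t x y * d_y p f t x y)"

definition delta_x :: "(4 \<Rightarrow> 4 \<Rightarrow> jet_fun) \<Rightarrow> 4 \<Rightarrow> jet_fun \<Rightarrow> jet_fun" where
  "delta_x N i f t x y = d_x i f t x y - (\<Sum>p\<in>UNIV. N p i t x y * d_y p f t x y)"

definition fund_tensor :: "(real \<Rightarrow> real) \<Rightarrow> jet_fun \<Rightarrow> 4 \<Rightarrow> 4 \<Rightarrow> jet_fun" where
  "fund_tensor h F i j t x y = h t / 2 * d_y i (d_y j (\<lambda>t x y. (F t x y)\<^sup>2)) t x y"

definition inv_fund_tensor :: "(real \<Rightarrow> real) \<Rightarrow> jet_fun \<Rightarrow> 4 \<Rightarrow> 4 \<Rightarrow> jet_fun" where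
  "inv_fund_tensor h F i j t x y = matrix_inv (\<chi> a b. fund_tensor h F a b t x y) $ i $ j"

text \<open>In all component functions the upper index comes first: \<open>cartan_G _ _ _ k j\<close> is
  $G^k_{j1}$, \<open>cartan_L _ _ _ i j k\<close> is $L^i_{jk}$ and \<open>cartan_C _ _ i j k\<close> is
  $C^{i(1)}_{j(k)}$.\<close>

definition cartan_G :: "(real \<Rightarrow> real) \<Rightarrow> jet_fun \<Rightarrow> (4 \<Rightarrow> jet_fun) \<Rightarrow> 4 \<Rightarrow> 4 \<Rightarrow> jet_fun" where
  "cartan_G h F M k j t x y =
     (\<Sum>m\<in>UNIV. inv_fund_tensor h F k m t x y / 2 * delta_t M (fund_tensor h F m j) t x y)"

definition cartan_L ::
  "(real \<Rightarrow> real) \<Rightarrow> jet_fun \<Rightarrow> (4 \<Rightarrow> 4 \<Rightarrow> jet_fun) \<Rightarrow> 4 \<Rightarrow> 4 \<Rightarrow> 4 \<Rightarrow> jet_fun" where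
  "cartan_L h F N i j k t x y =
     (\<Sum>m\<in>UNIV. inv_fund_tensor h F i m t x y / 2 *
        (delta_x N k (fund_tensor h F j m) t x y
         + delta_x N j (fund_tensor h F k m) t x y
         - delta_x N m (fund_tensor h F j k) t x y))"

definition cartan_C :: "(real \<Rightarrow> real) \<Rightarrow> jet_fun \<Rightarrow> 4 \<Rightarrow> 4 \<Rightarrow> 4 \<Rightarrow> jet_fun" where
  "cartan_C h F i j k t x y =
     (\<Sum>m\<in>UNIV. inv_fund_tensor h F i m t x y / 2 *
        (d_y k (fund_tensor h F j m) t x y
         + d_y j (fund_tensor h F k m) t x y
         - d_y m (fund_tensor h F j k) t x y))"

definition cartan_connection ::
  "(real \<Rightarrow> real) \<Rightarrow> jet_fun \<Rightarrow> (4 \<Rightarrow> jet_fun) \<Rightarrow> (4 \<Rightarrow> 4 \<Rightarrow> jet_fun) \<Rightarrow>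
     real \<Rightarrow> real ^ 4 \<Rightarrow> real ^ 4 \<Rightarrow>
     real \<times> (4 \<Rightarrow> 4 \<Rightarrow> real) \<times> (4 \<Rightarrow> 4 \<Rightarrow> 4 \<Rightarrow> real) \<times> (4 \<Rightarrow> 4 \<Rightarrow> 4 \<Rightarrow> real)" where
  "cartan_connection h F M N t x y =
     (christoffel h t,
      \<lambda>k j. cartan_G h F M k j t x y,
      \<lambda>i j k. cartan_L h F N i j k t x y,
      \<lambda>i j k. cartan_C h F i j k t x y)"


section \<open>The jet conformal Minkowski metric\<close>

text \<open>Below, \<open>s\<close> is the expression of the conformal exponent in the chosen local coordinates.\<close>

definition G11 :: "real ^ 4 \<Rightarrow> real" where
  "G11 y = y $ 1 * y $ 2 + y $ 1 * y $ 3 + y $ 1 * y $ 4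
         + y $ 2 * y $ 3 + y $ 2 * y $ 4 + y $ 3 * y $ 4"

definition minkowski_F :: "(real \<Rightarrow> real) \<Rightarrow> (real ^ 4 \<Rightarrow> real) \<Rightarrow> jet_fun" where
  "minkowski_F h s t x y = exp (s x) * sqrt (1 / h t) * sqrt (G11 y)"

definition divD :: "(real ^ 4 \<Rightarrow> real) \<Rightarrow> real ^ 4 \<Rightarrow> real" where
  "divD s x = partial 1 s x + partial 2 s x + partial 3 s x + partial 4 s x"

definition S1 :: "real ^ 4 \<Rightarrow> real" where
  "S1 y = y $ 1 + y $ 2 + y $ 3 + y $ 4"

definition minkowski_M :: "(real \<Rightarrow> real) \<Rightarrow> 4 \<Rightarrow> jet_fun" where
  "minkowski_M h i t x y = - christoffel h t * y $ i"

definition minkowski_N :: "(real ^ 4 \<Rightarrow> real) \<Rightarrow> 4 \<Rightarrow> 4 \<Rightarrow> jet_fun" where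
  "minkowski_N s i j t x y =
     partial j s x * y $ i
     + (\<Sum>m\<in>UNIV. partial m s x * y $ m) * kdelta i j
     + (partial i s x - 1 / 3 * divD s x) * (S1 y - y $ j)"

end

theory Submission
  imports Defs
begin

text \<open>On the open set \<^term>\<open>{y. G11 y > 0}\<close> the square of the metric is
  $e^{2\sigma} G_{11} / h_{11}$, so that $g_{ij} = e^{2\sigma}(1 - \delta_{ij})/2$ depends neither on
  $t$ nor on $y$. Hence every vertical derivative of $g$ vanishes, $\delta/\delta x^k$ acts on $g$ as
  $\partial/\partial x^k$, i.e. as multiplication by $2\sigma_k$, and the nonlinear
  connection drops out. The remaining contraction uses
  $g^{ij} = 2 e^{-2\sigma}(1/3 - \delta_{ij})$.\<close>

text \<open>\<open>partial\<close> only sees values near the base point. This localization is needed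
  because $F^2$ is a multiple of \<open>G11\<close> only where \<open>G11\<close> is positive:
  \<open>sqrt\<close> is extended as an odd function, so elsewhere the square yields
  \<open>\<bar>G11 y\<bar>\<close>.\<close>

lemma partial_cong_open:
  assumes "open S" "x \<in> S" "\<And>z. z \<in> S \<Longrightarrow> f z = g z"
  shows "partial i f x = partial i g x"
proof -
  have "((\<lambda>r::real. x + r *\<^sub>R axis i 1) \<longlongrightarrow> x + 0 *\<^sub>R axis i 1) (nhds 0)"
    by (intro tendsto_intros filterlim_ident)
  then have "\<forall>\<^sub>F r in nhds (0::real). x + r *\<^sub>R axis i 1 \<in> S"
    using assms(1,2) by (simp add: topological_tendstoD)
  then have "\<forall>\<^sub>F r in nhds (0::real). f (x + r *\<^sub>R axis i 1) = g (x + r *\<^sub>R axis i 1)"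
    by eventually_elim (rule assms(3))
  then show ?thesis
    unfolding partial_def by (rule deriv_cong_ev) simp
qed

lemma partial_const [simp]: "partial i (\<lambda>z. c) x = 0"
  by (simp add: partial_def)

text \<open>\<open>deriv\<close> is a choice operator, so differentiability is what makes
  \<open>partial\<close> a true derivative, usable in the chain rule for
  \<open>exp (2 * s x)\<close>.\<close>

lemma has_field_derivative_partial:
  fixes f :: "real ^ 4 \<Rightarrow> real"
  assumes "f differentiable (at x)"
  shows "((\<lambda>r. f (x + r *\<^sub>R axis i 1)) has_field_derivative partial i f x) (at 0)"
proof -
  have line: "((\<lambda>r::real. x + r *\<^sub>R axis i 1) has_derivative (\<lambda>r. r *\<^sub>R axis i 1)) (at 0)"
    by (auto intro!: derivative_eq_intros)
  from assms obtain f' where "(f has_derivative f') (at x)"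
    by (auto simp: differentiable_def)
  then have "(f has_derivative f') (at (x + 0 *\<^sub>R axis i 1))"
    by simp
  from has_derivative_compose[OF line this]
  have "(\<lambda>r::real. f (x + r *\<^sub>R axis i 1)) differentiable (at 0)"
    by (auto simp: differentiable_def)
  then show ?thesis
    by (simp add: partial_def DERIV_deriv_iff_real_differentiable)
qed

lemma open_G11_pos: "open {y. G11 y > 0}"
  unfolding G11_def by (intro open_Collect_less continuous_intros)

lemma partial_G11: "partial j (\<lambda>y. c * G11 y) y = c * (S1 y - y $ j)"
  unfolding partial_def G11_def S1_def
  using exhaust_4[of j]
  by (intro DERIV_imp_deriv) (auto intro!: derivative_eq_intros simp: axis_def algebra_simps)

lemma partial_S1_diff: "partial i (\<lambda>y. c * (S1 y - y $ j)) y = c * (1 - kdelta i j)"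
  unfolding partial_def S1_def kdelta_def
  using exhaust_4[of i] exhaust_4[of j]
  by (intro DERIV_imp_deriv) (auto intro!: derivative_eq_intros simp: axis_def algebra_simps)

lemma matrix_inv_eqI:
  fixes A B :: "'a::field ^ 'n ^ 'n"
  assumes "A ** B = mat 1"
  shows "matrix_inv A = B"
proof -
  have BA: "B ** A = mat 1"
    using assms by (simp add: matrix_left_right_inverse)
  \<comment> \<open>\<open>matrix_inv\<close> chooses some two-sided inverse; \<open>B\<close> shows
    that one exists, and uniqueness then follows by associativity.\<close>
  have inv: "A ** matrix_inv A = mat 1"
    unfolding matrix_inv_def by (rule someI2[where a = B]) (use assms BA in auto)
  have "matrix_inv A = (B ** A) ** matrix_inv A"
    by (simp add: BA)
  also have "\<dots> = B"
    by (simp only: matrix_mul_assoc[symmetric] inv matrix_mul_rid)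
  finally show ?thesis .
qed

lemma fund_tensor_minkowski:
  assumes "\<And>t. h t > 0" "G11 y > 0"
  shows "fund_tensor h (minkowski_F h s) i j t x y = exp (2 * s x) / 2 * (1 - kdelta i j)"
proof -
  let ?c = "exp (2 * s x) / h t"
  have F2: "(minkowski_F h s t x z)\<^sup>2 = ?c * G11 z" if "G11 z > 0" for z
    using that assms(1)[of t]
    by (simp add: minkowski_F_def power_mult_distrib exp_double)
  \<comment> \<open>Stated for every \<open>z\<close> in the domain, since the outer derivative
    needs the inner one on a neighbourhood of \<open>y\<close>.\<close>
  have "d_y j (\<lambda>t x y. (minkowski_F h s t x y)\<^sup>2) t x z = ?c * (S1 z - z $ j)"
    if "G11 z > 0" for z
    unfolding d_y_def
    by (rule trans[OF partial_cong_open[OF open_G11_pos] partial_G11]) (use F2 that in auto)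
  then have "d_y i (d_y j (\<lambda>t x y. (minkowski_F h s t x y)\<^sup>2)) t x y = ?c * (1 - kdelta i j)"
    unfolding d_y_def[of i]
    by (intro trans[OF partial_cong_open[OF open_G11_pos] partial_S1_diff]) (use assms(2) in auto)
  then show ?thesis
    using assms(1)[of t] by (simp add: fund_tensor_def)
qed

text \<open>With J the all-ones matrix, J J = 4 J, so (J - I)(J/3 - I) = (4/3 - 1 - 1/3) J + I =
  I.\<close>

lemma inv_fund_tensor_minkowski:
  assumes "\<And>t. h t > 0" "G11 y > 0"
  shows "inv_fund_tensor h (minkowski_F h s) i j t x y = 2 * exp (- 2 * s x) * (1/3 - kdelta i j)"
proof -
  let ?A = "\<chi> a b. fund_tensor h (minkowski_F h s) a b t x y"
  let ?B = "(\<chi> a b. 2 * exp (- 2 * s x) * (1/3 - kdelta a b)) :: real ^ 4 ^ 4"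
  have e: "exp (2 * s x) * exp (- (2 * s x)) = 1"
    by (simp flip: exp_add)
  have prod: "(\<Sum>m\<in>UNIV. (1 - kdelta a m) * (1/3 - kdelta m b)) = kdelta a b" for a b
    using exhaust_4[of a] exhaust_4[of b] by (auto simp: sum_4 kdelta_def)
  have entry: "(?A ** ?B) $ a $ b = (\<Sum>m\<in>UNIV. (exp (2 * s x) * exp (- (2 * s x))) *
      ((1 - kdelta a m) * (1/3 - kdelta m b)))" for a b
    by (simp add: matrix_matrix_mult_def fund_tensor_minkowski[OF assms] ac_simps)
  have AB: "?A ** ?B = mat 1"
    by (simp only: vec_eq_iff entry e mult_1 prod) (simp add: mat_def kdelta_def)
  then have "matrix_inv ?A = ?B"
    by (rule matrix_inv_eqI)
  then show ?thesis
    by (simp add: inv_fund_tensor_def)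
qed

lemma d_y_fund_tensor_minkowski:
  assumes "\<And>t. h t > 0" "G11 y > 0"
  shows "d_y p (fund_tensor h (minkowski_F h s) i j) t x y = 0"
  unfolding d_y_def using assms(2)
  by (subst partial_cong_open[OF open_G11_pos, where g = "\<lambda>_. exp (2 * s x) / 2 * (1 - kdelta i j)"])
    (auto simp: fund_tensor_minkowski[OF assms(1)])

lemma d_t_fund_tensor_minkowski:
  assumes "\<And>t. h t > 0" "G11 y > 0"
  shows "d_t (fund_tensor h (minkowski_F h s) i j) t x y = 0"
  by (simp add: d_t_def fund_tensor_minkowski[OF assms])

lemma d_x_fund_tensor_minkowski:
  assumes "\<And>t. h t > 0" "G11 y > 0" "s differentiable (at x)"
  shows "d_x k (fund_tensor h (minkowski_F h s) i j) t x y
    = exp (2 * s x) * partial k s x * (1 - kdelta i j)"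
proof -
  note [derivative_intros] = has_field_derivative_partial[OF assms(3), of k]
  show ?thesis
    \<comment> \<open>The pattern unfolds only the derivative of the tensor;
      \<open>partial k s x\<close> stays folded to match the rule just declared.\<close>
    unfolding d_x_def fund_tensor_minkowski[OF assms(1,2)] partial_def[of k "\<lambda>z. _ z / 2 * _"]
    by (rule DERIV_imp_deriv) (auto intro!: derivative_eq_intros)
qed

text \<open>\<open>N\<close> is arbitrary, as it only multiplies vanishing vertical derivatives. The
  factor \<open>1/3 - kdelta i m\<close> inverts \<open>1 - kdelta j m\<close>, so the first two
  terms contract to Kronecker symbols; contracted with \<open>partial m s x\<close> it gives
  \<open>divD s x / 3 - partial i s x\<close>.\<close>

lemma cartan_L_minkowski:
  assumes "\<And>t. h t > 0" "G11 y > 0" "s differentiable (at x)"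
  shows "cartan_L h (minkowski_F h s) N i j k t x y =
    kdelta i j * partial k s x + kdelta i k * partial j s x
    + (1 - kdelta j k) * partial i s x - (1 - kdelta j k) / 3 * divD s x"
proof -
  have e: "exp (- (2 * s x)) * exp (2 * s x) = 1"
    by (simp flip: exp_add)
  have "cartan_L h (minkowski_F h s) N i j k t x y =
    (\<Sum>m\<in>UNIV. (exp (- (2 * s x)) * exp (2 * s x)) * ((1/3 - kdelta i m) *
      (partial k s x * (1 - kdelta j m) + partial j s x * (1 - kdelta k m)
        - partial m s x * (1 - kdelta j k))))"
    by (simp add: cartan_L_def delta_x_def inv_fund_tensor_minkowski[OF assms(1,2)]
        d_y_fund_tensor_minkowski[OF assms(1,2)] d_x_fund_tensor_minkowski[OF assms])
      (simp add: algebra_simps)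
  also have "\<dots> = kdelta i j * partial k s x + kdelta i k * partial j s x
    + (1 - kdelta j k) * partial i s x - (1 - kdelta j k) / 3 * divD s x"
    unfolding e
    using exhaust_4[of i] exhaust_4[of j] exhaust_4[of k]
    \<comment> \<open>For each of the 64 index triples this is a linear identity in the four partial
      derivatives of \<open>s\<close>.\<close>
    by (elim disjE; simp add: sum_4 kdelta_def divD_def; simp add: field_simps)
  finally show ?thesis .
qed

theorem proposition3p1:
  fixes A :: "'m::{t2_space, second_countable_topology} chart set"
    and U :: "'m set" and \<phi> :: "'m \<Rightarrow> real ^ 4"
    and \<sigma> :: "'m \<Rightarrow> real" and s :: "real ^ 4 \<Rightarrow> real"
    and h :: "real \<Rightarrow> real"
    and t :: real and x y :: "real ^ 4"
  assumes "smooth_atlas A" and "(U, \<phi>) \<in> A"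
    and "smooth_function A \<sigma>" and "\<not> \<sigma> constant_on UNIV"
    and "smooth_on h UNIV" and "\<And>t. h t > 0"
    and "s = in_chart (U, \<phi>) \<sigma>"
    and "x \<in> \<phi> ` U" and "G11 y > 0"
  shows "cartan_connection h (minkowski_F h s) (minkowski_M h) (minkowski_N s) t x y =
    (christoffel h t,
     \<lambda>k j. 0,
     \<lambda>i j k. kdelta i j * partial k s x + kdelta i k * partial j s x
              + (1 - kdelta j k) * partial i s x
              - (1 - kdelta j k) / 3 * divD s x,
     \<lambda>i j k. 0)"
proof -
  have "smooth_on s (\<phi> ` U)"
    using assms(2,3,7) by (force simp: smooth_function_def)
  \<comment> \<open>Level one of smoothness contains differentiability at each point of the chart
    image.\<close>
  then have "Ck_on (Suc 0) s (\<phi> ` U)"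
    by (simp only: smooth_on_def)
  then have "s differentiable (at x)"
    using assms(8) by auto
  note L = cartan_L_minkowski[OF assms(6,9) this]
  show ?thesis
    \<comment> \<open>The G and C components vanish termwise: each summand carries a derivative of
      $g$ in \<open>t\<close> or \<open>y\<close>.\<close>
    by (simp add: cartan_connection_def L cartan_G_def cartan_C_def delta_t_def
        d_y_fund_tensor_minkowski[OF assms(6,9)] d_t_fund_tensor_minkowski[OF assms(6,9)])
qed

end
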